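(* Let $L$ be a Lie algebra having a nondegenerate, invariant bilinear form $b$. Then $F(L)=L$. In particular, $L$ does not admit a CP unless $L$ is abelian.
   Context: All Lie algebras are finite-dimensional over a field $k$ of characteristic zero. For a Lie algebra $L$ and $f\in L^*$, put $L(f)=\{x\in L\mid f([x,y])=0 \text{ for all } y\in L\}$. The index of $L$ is $i(L)=\min_{f\in L^*}\dim L(f)$, and $f$ is called regular if $\dim L(f)=i(L)$; $L^*_{\mathrm{reg}}$ denotes the set of regular $f\in L^*$. The Frobenius semiradical of $L$ is $F(L)=\sum_{f\in L^*_{\mathrm{reg}}}L(f)$. A CP (commutative polarization) of $L$ is a commutative Lie subalgebra $P$ which is a polarization with respect to some $f\in L^*$, i.e. $f([P,P])=0$ and $\dim P=\frac12(\dim L+\dim L(f))$; equivalently, a commutative Lie subalgebra $P$ with $\dim P=\frac12(\dim L+i(L))$. A bilinear form $b$ on $L$ is invariant if $b([x,y],z)=b(x,[y,z])$ for all $x,y,z\in L$. *)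

theory Defs
  imports Complex_Main
begin

definition bilinear_map ::
    "('k::field \<Rightarrow> 'a::ab_group_add \<Rightarrow> 'a) \<Rightarrow> ('k \<Rightarrow> 'b::ab_group_add \<Rightarrow> 'b) \<Rightarrow>
     ('k \<Rightarrow> 'c::ab_group_add \<Rightarrow> 'c) \<Rightarrow> ('a \<Rightarrow> 'b \<Rightarrow> 'c) \<Rightarrow> bool" where
  "bilinear_map s1 s2 s3 h \<longleftrightarrow>
     (\<forall>x. Vector_Spaces.linear s2 s3 (\<lambda>y. h x y)) \<and>
     (\<forall>y. Vector_Spaces.linear s1 s3 (\<lambda>x. h x y))"

text \<open>The Lie algebra is the whole type \<open>'l\<close>, with an arbitrary ground field \<open>'k\<close> of
  characteristic zero acting on it through \<open>scale\<close>.\<close>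

locale lie_algebra = vector_space scale
  for scale :: "'k::field_char_0 \<Rightarrow> 'l::ab_group_add \<Rightarrow> 'l" +
  fixes bracket :: "'l \<Rightarrow> 'l \<Rightarrow> 'l"
  assumes finite_dimensional: "\<exists>B. finite B \<and> span B = UNIV"
    and bracket_bilinear: "bilinear_map scale scale scale bracket"
    and bracket_alternating: "bracket x x = 0"
    and jacobi: "bracket x (bracket y z) + bracket y (bracket z x) + bracket z (bracket x y) = 0"
begin

definition dual :: "('l \<Rightarrow> 'k) set" where
  "dual = {f. Vector_Spaces.linear scale (*) f}"

definition stabilizer :: "('l \<Rightarrow> 'k) \<Rightarrow> 'l set" where
  "stabilizer f = {x. \<forall>y. f (bracket x y) = 0}"

definition index :: nat where
  "index = (LEAST n. \<exists>f\<in>dual. n = dim (stabilizer f))"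

definition regular :: "('l \<Rightarrow> 'k) set" where
  "regular = {f \<in> dual. dim (stabilizer f) = index}"

text \<open>The sum of a family of subspaces is the span of its union.\<close>

definition frobenius_semiradical :: "'l set" where
  "frobenius_semiradical = span (\<Union>f\<in>regular. stabilizer f)"

definition lie_subalgebra :: "'l set \<Rightarrow> bool" where
  "lie_subalgebra P \<longleftrightarrow> subspace P \<and> (\<forall>x\<in>P. \<forall>y\<in>P. bracket x y \<in> P)"

definition commutative :: "'l set \<Rightarrow> bool" where
  "commutative P \<longleftrightarrow> (\<forall>x\<in>P. \<forall>y\<in>P. bracket x y = 0)"

definition polarization :: "('l \<Rightarrow> 'k) \<Rightarrow> 'l set \<Rightarrow> bool" where
  "polarization f P \<longleftrightarrow> lie_subalgebra P \<and> (\<forall>x\<in>P. \<forall>y\<in>P. f (bracket x y) = 0) \<and>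
     2 * dim P = dim (UNIV :: 'l set) + dim (stabilizer f)"

definition commutative_polarization :: "'l set \<Rightarrow> bool" where
  "commutative_polarization P \<longleftrightarrow>
     lie_subalgebra P \<and> commutative P \<and> (\<exists>f\<in>dual. polarization f P)"

definition abelian :: bool where
  "abelian \<longleftrightarrow> commutative UNIV"

definition invariant_form :: "('l \<Rightarrow> 'l \<Rightarrow> 'k) \<Rightarrow> bool" where
  "invariant_form b \<longleftrightarrow> (\<forall>x y z. b (bracket x y) z = b x (bracket y z))"

end

text \<open>The form need not be symmetric, so nondegeneracy is imposed on both sides.\<close>

definition nondegenerate :: "('a::zero \<Rightarrow> 'a \<Rightarrow> 'k::zero) \<Rightarrow> bool" where
  "nondegenerate b \<longleftrightarrow>
     (\<forall>x. (\<forall>y. b x y = 0) \<longrightarrow> x = 0) \<and> (\<forall>y. (\<forall>x. b x y = 0) \<longrightarrow> y = 0)"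

end

theory Submission
  imports Defs
begin

text \<open>
  Nondegeneracy of \<open>b\<close> turns every functional into some \<open>b x\<close>, and invariance turns its stabilizer
  into the centralizer of \<open>x\<close>, which contains \<open>x\<close>. It remains to see that the elements whose
  centralizer has minimal dimension span \<open>L\<close>: if \<open>x\<close> is one of them, then so is \<open>x + t y\<close> for all
  but finitely many \<open>t\<close>, because the kernel of a linear map can only grow at finitely many
  parameters of a pencil; hence \<open>y\<close> is a combination of two of them.

  As for commutative polarizations, \<open>P + L(g)\<close> is isotropic for every functional \<open>g\<close> whenever \<open>P\<close> is
  commutative, and the dimension bound for isotropic subspaces forces \<open>L(g) \<subseteq> P\<close> for regular
  \<open>g\<close>. So a commutative polarization contains \<open>F(L)\<close>.
\<close>

section \<open>Linear algebra\<close>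

lemma vector_space_mult: "vector_space ((*) :: 'a::field \<Rightarrow> 'a \<Rightarrow> 'a)"
  by unfold_locales (simp_all add: algebra_simps)

text \<open>Packs a family of functionals into one endomorphism by using each value as the
  coefficient of a basis vector. Arguments about the dual space can then be run with dimension
  counts inside the space itself.\<close>

lemma (in vector_space) linear_coordinate_sum:
  assumes "\<And>e. e \<in> B \<Longrightarrow> Vector_Spaces.linear scale (*) (g e)"
  shows "Vector_Spaces.linear scale scale (\<lambda>x. \<Sum>e\<in>B. scale (g e x) e)"
proof -
  have g: "g e (x + y) = g e x + g e y" "g e (scale c x) = c * g e x" if "e \<in> B" for e x y c
    using assms[OF that] by (auto simp: Vector_Spaces.linear_iff)
  show ?thesis
    unfolding Vector_Spaces.linear_iff
  proof (intro conjI allI vector_space_axioms)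
    show "(\<Sum>e\<in>B. scale (g e (x + y)) e) = (\<Sum>e\<in>B. scale (g e x) e) + (\<Sum>e\<in>B. scale (g e y) e)" for x y
      by (simp add: g(1) scale_left_distrib sum.distrib)
    show "(\<Sum>e\<in>B. scale (g e (scale c x)) e) = scale c (\<Sum>e\<in>B. scale (g e x) e)" for c x
      by (simp add: g(2) scale_sum_right)
  qed
qed

context finite_dimensional_vector_space
begin

text \<open>A basis \<open>C\<close> of \<open>K\<close> extends to a basis \<open>B\<close> of
  \<open>Q\<close>, and \<open>B - C\<close> spans the complement.\<close>

lemma subspace_complement_exists:
  assumes "subspace K" "subspace Q" "K \<subseteq> Q"
  obtains W where "subspace W" "W \<subseteq> Q" "K \<inter> W = {0}" "{x + y |x y. x \<in> K \<and> y \<in> W} = Q"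
    "dim K + dim W = dim Q"
proof -
  obtain C where C: "C \<subseteq> K" "independent C" "K \<subseteq> span C" "card C = dim K"
    using basis_exists by blast
  have spC: "span C = K"
    using C assms(1) by (simp add: span_minimal subset_antisym)
  obtain B where B: "C \<subseteq> B" "B \<subseteq> Q" "independent B" "Q \<subseteq> span B"
    using maximal_independent_subset_extend[of C Q] C assms(3) by (metis order.trans)
  have spB: "span B = Q"
    using B assms(2) by (simp add: span_minimal subset_antisym)
  have fB: "finite B"
    using B finiteI_independent by blast
  define W where "W = span (B - C)"
  have dimW: "dim W = card (B - C)"
    unfolding W_def using B(3) by (metis Diff_subset dim_span_eq_card_independent independent_mono)
  have cB: "card B = dim Q"
    using B basis_card_eq_dim by blast
  have dims: "dim K + dim W = dim Q"
    using dimW C(4) cB card_Diff_subset[of C B] card_mono[OF fB B(1)] B(1) fB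
    by (simp add: finite_subset)
  have sW: "subspace W"
    by (simp add: W_def)
  have WQ: "W \<subseteq> Q"
    unfolding W_def using B assms(2) by (meson Diff_subset order.trans span_minimal)
  have sum: "{x + y |x y. x \<in> K \<and> y \<in> W} = Q"
    using span_Un[of C "B - C"] B(1) spB spC W_def by (simp add: Un_absorb1)
  \<comment> \<open>The sum already has dimension \<open>dim K + dim W\<close>, which leaves nothing
    for the intersection.\<close>
  have "dim (K \<inter> W) = 0"
    using dim_sums_Int[OF assms(1) sW] dims sum by simp
  then have "K \<inter> W = {0}"
    using subspace_0[OF assms(1)] subspace_0[OF sW] by auto
  with that sW WQ sum dims show thesis by blast
qed

text \<open>Rank-nullity for \<open>T\<close> restricted to \<open>Q\<close>: a complement of the
  kernel within \<open>Q\<close> is mapped injectively.\<close>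

lemma dim_le_kernel_plus_image:
  assumes T: "Vector_Spaces.linear scale scale T" and Q: "subspace Q"
  shows "dim Q \<le> dim (Q \<inter> {x. T x = 0}) + dim (T ` Q)"
proof -
  interpret T: Vector_Spaces.linear scale scale T by fact
  interpret pair: finite_dimensional_vector_space_pair scale Basis scale Basis ..
  have sK: "subspace (Q \<inter> {x. T x = 0})"
    using Q T.subspace_kernel subspace_inter by blast
  obtain W where W: "subspace W" "W \<subseteq> Q" "(Q \<inter> {x. T x = 0}) \<inter> W = {0}"
    "dim (Q \<inter> {x. T x = 0}) + dim W = dim Q"
    by (rule subspace_complement_exists[OF sK Q inf_le1]) (rule that)
  have "inj_on T W"
    using W T.inj_on_iff_eq_0[OF W(1)] by auto
  then have "inj_on T (span W)"
    using W(1) by (simp only: span_eq_iff[THEN iffD2])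
  then have "dim (T ` W) = dim W"
    using pair.dim_image_eq[OF T] by blast
  moreover have "dim (T ` W) \<le> dim (T ` Q)"
    using W(2) by (intro dim_subset image_mono)
  ultimately show ?thesis
    using W(4) by linarith
qed

section \<open>Eigenvalues, and kernels in a pencil of linear maps\<close>

lemma eigenvectors_scalars_zero:
  assumes T: "Vector_Spaces.linear scale scale T" and "finite S"
    and "\<And>l. l \<in> S \<Longrightarrow> v l \<noteq> 0" and "\<And>l. l \<in> S \<Longrightarrow> T (v l) = scale l (v l)"
    and "(\<Sum>l\<in>S. scale (c l) (v l)) = 0" and "l \<in> S"
  shows "c l = 0"
  using assms(2-)
proof (induction S arbitrary: c l rule: finite_induct)
  case empty
  then show ?case by simp
next
  case (insert m S)
  interpret T: Vector_Spaces.linear scale scale T by fact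
  have 0: "scale (c m) (v m) + (\<Sum>l\<in>S. scale (c l) (v l)) = 0"
    using insert by simp
  \<comment> \<open>Applying \<open>T - m\<close> to the relation removes the term of
    \<open>m\<close> and multiplies the coefficient at each other \<open>l\<close> by
    \<open>l - m\<close>, which is nonzero on \<open>S\<close>.\<close>
  have "0 = T (scale (c m) (v m) + (\<Sum>l\<in>S. scale (c l) (v l)))
      - scale m (scale (c m) (v m) + (\<Sum>l\<in>S. scale (c l) (v l)))"
    unfolding 0 by simp
  also have "\<dots> = (\<Sum>l\<in>S. scale (c l * l) (v l)) - (\<Sum>l\<in>S. scale (m * c l) (v l))"
    using insert.prems(2)
    by (simp add: T.add T.scale T.sum scale_right_distrib scale_sum_right mult.commute)
  also have "\<dots> = (\<Sum>l\<in>S. scale (c l * (l - m)) (v l))"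
    by (simp add: right_diff_distrib scale_left_diff_distrib sum_subtractf mult.commute)
  finally have "(\<Sum>l\<in>S. scale (c l * (l - m)) (v l)) = 0" by simp
  then have "c l * (l - m) = 0" if "l \<in> S" for l
    using insert.IH[of "\<lambda>l. c l * (l - m)" l] insert.prems that by simp
  then have *: "c l = 0" if "l \<in> S" for l
    using that insert.hyps by fastforce
  then have "scale (c m) (v m) = 0"
    using 0 by simp
  then have "c m = 0"
    using insert.prems(1) by simp
  with * insert.prems show ?case by auto
qed

text \<open>Eigenvectors chosen for distinct eigenvalues are independent, so no finite set of
  eigenvalues has more than \<open>dimension\<close> elements.\<close>

lemma finite_eigenvalues:
  assumes T: "Vector_Spaces.linear scale scale T"
  shows "finite {l. \<exists>v. v \<noteq> 0 \<and> T v = scale l v}" (is "finite ?E")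
proof -
  define v where "v l = (SOME v. v \<noteq> 0 \<and> T v = scale l v)" for l
  have v: "v l \<noteq> 0 \<and> T (v l) = scale l (v l)" if "l \<in> ?E" for l
    using that unfolding v_def mem_Collect_eq by (rule someI_ex)
  have "card S \<le> dimension" if S: "finite S" "S \<subseteq> ?E" for S
  proof -
    note v0 = conjunct1[OF v[OF subsetD[OF S(2)]]] and vT = conjunct2[OF v[OF subsetD[OF S(2)]]]
    have inj: "inj_on v S"
    proof (rule inj_onI)
      fix l m assume l: "l \<in> S" and m: "m \<in> S" and eq: "v l = v m"
      have "T (v m) = scale l (v m)"
        using vT[OF l] unfolding eq .
      with v0[OF m] vT[OF m] show "l = m"
        by (metis scale_right_imp_eq)
    qed
    have "independent (v ` S)"
    proof (rule independent_if_scalars_zero)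
      fix f x assume "(\<Sum>x\<in>v ` S. scale (f x) x) = 0" "x \<in> v ` S"
      then obtain l where l: "x = v l" "l \<in> S" and 0: "(\<Sum>l\<in>S. scale (f (v l)) (v l)) = 0"
        by (auto simp: sum.reindex[OF inj])
      have "f (v l) = 0"
        by (rule eigenvectors_scalars_zero[OF T S(1) v0 vT 0 l(2)])
      then show "f x = 0"
        unfolding l(1) .
    qed (use S in simp)
    then have "card (v ` S) \<le> dim (v ` S)"
      using independent_bound_general by blast
    also have "\<dots> \<le> dimension" by (rule dim_subset_UNIV)
    finally show ?thesis
      using card_image[OF inj] by simp
  qed
  then show ?thesis
    using finite_if_finite_subsets_card_bdd[of ?E dimension] by blast
qed

text \<open>If \<open>q\<close> inverts \<open>A\<close> on a complement \<open>W\<close> of its kernel, a larger kernel of \<open>A + t B\<close> meets \<open>W\<close>,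
  and any vector in the intersection is an eigenvector of \<open>q \<circ> B\<close> for \<open>- 1 / t\<close>.\<close>

lemma finite_kernel_pencil_jumps:
  assumes A: "Vector_Spaces.linear scale scale A" and B: "Vector_Spaces.linear scale scale B"
  shows "finite {t. dim {x. A x = 0} < dim {x. A x + scale t (B x) = 0}}" (is "finite ?J")
proof -
  interpret A: Vector_Spaces.linear scale scale A by fact
  interpret B: Vector_Spaces.linear scale scale B by fact
  interpret pair: vector_space_pair scale scale ..
  obtain W where W: "subspace W" "{x. A x = 0} \<inter> W = {0}"
    "dim {x. A x = 0} + dim W = dim (UNIV :: 'b set)"
    by (rule subspace_complement_exists[OF A.subspace_kernel subspace_UNIV subset_UNIV]) (rule that)
  have "inj_on A W"
    using W A.inj_on_iff_eq_0[OF W(1)] by auto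
  then obtain q where q: "Vector_Spaces.linear scale scale q" "\<And>w. w \<in> W \<Longrightarrow> q (A w) = w"
    using pair.linear_exists_left_inverse_on[OF A W(1)] by auto
  interpret q: Vector_Spaces.linear scale scale q by fact
  let ?E = "{l. \<exists>v. v \<noteq> 0 \<and> (q \<circ> B) v = scale l v}"
  have "finite ?E"
    using Vector_Spaces.linear_compose[OF B q(1)] by (rule finite_eigenvalues)
  moreover have "?J \<subseteq> (\<lambda>l. - 1 / l) ` ?E"
  proof
    fix t assume t: "t \<in> ?J"
    let ?K = "{x. A x + scale t (B x) = 0}"
    \<comment> \<open>At \<open>t = 0\<close> the two kernels coincide, so the strict inequality
      excludes this value.\<close>
    have "t \<noteq> 0" using t by auto
    have sK: "subspace ?K"
      by (intro pair.linear_subspace_kernel pair.linear_compose_add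
          pair.linear_compose_scale_right A B)
    \<comment> \<open>Because of the jump, the dimensions of \<open>?K\<close> and \<open>W\<close>
      add up to more than that of the whole space, so the two share a nonzero vector.\<close>
    have "dim {x + y |x y. x \<in> ?K \<and> y \<in> W} \<le> dim (UNIV :: 'b set)"
      by (rule dim_subset) simp
    then have "dim (?K \<inter> W) \<noteq> 0"
      using dim_sums_Int[OF sK W(1)] W(3) t unfolding mem_Collect_eq by linarith
    then obtain w where w: "w \<in> ?K" "w \<in> W" "w \<noteq> 0"
      by auto
    have "q (A w + scale t (B w)) = 0"
      using w(1) q.zero by simp
    then have "w + scale t (q (B w)) = 0"
      using q(2)[OF w(2)] by (simp add: q.add q.scale)
    then have "scale t (q (B w)) = - w"
      by (simp add: eq_neg_iff_add_eq_0 add.commute)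
    then have "scale (1 / t) (scale t (q (B w))) = scale (1 / t) (- w)"
      by simp
    then have "(q \<circ> B) w = scale (- 1 / t) w"
      using \<open>t \<noteq> 0\<close> by simp
    then have "- 1 / t \<in> ?E"
      using w(3) by blast
    then show "t \<in> (\<lambda>l. - 1 / l) ` ?E"
      by (rule rev_image_eqI) (use \<open>t \<noteq> 0\<close> in simp)
  qed
  ultimately show ?thesis
    using finite_surj by blast
qed

text \<open>Coordinates in \<open>Basis\<close> turn the map taking \<open>x\<close> to
  \<open>b x\<close> into an endomorphism \<open>\<Phi>\<close>. Nondegeneracy makes it injective,
  hence surjective by finite dimension.\<close>

lemma nondegenerate_form_represents:
  assumes b: "bilinear_map scale scale (*) b" and nd: "\<And>x. (\<And>y. b x y = 0) \<Longrightarrow> x = 0"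
    and f: "Vector_Spaces.linear scale (*) f"
  obtains x where "f = b x"
proof -
  have bl: "Vector_Spaces.linear scale (*) (\<lambda>x. b x y)" "Vector_Spaces.linear scale (*) (\<lambda>y. b x y)" for x y
    using b by (auto simp: bilinear_map_def)
  interpret pair: vector_space_pair scale "(*) :: 'a \<Rightarrow> 'a \<Rightarrow> 'a"
    by (simp add: vector_space_pair_def vector_space_axioms vector_space_mult)
  define \<Phi> where "\<Phi> x = (\<Sum>e\<in>Basis. scale (b x e) e)" for x
  have "Vector_Spaces.linear scale scale \<Phi>"
    unfolding \<Phi>_def by (intro linear_coordinate_sum bl(1))
  then interpret \<Phi>: Vector_Spaces.linear scale scale \<Phi> .
  have coeffs: "u e = w e"
    if "(\<Sum>e\<in>Basis. scale (u e) e) = (\<Sum>e\<in>Basis. scale (w e) e)" "e \<in> Basis" for u w e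
  proof -
    have "(\<Sum>e\<in>Basis. scale (u e - w e) e) = 0"
      using that by (simp add: scale_left_diff_distrib sum_subtractf)
    from independentD[OF independent_Basis finite_Basis subset_refl this that(2)]
    show ?thesis by simp
  qed
  have eqI: "g = h" if "Vector_Spaces.linear scale (*) g" "Vector_Spaces.linear scale (*) h" "\<And>e. e \<in> Basis \<Longrightarrow> g e = h e" for g h
  proof
    show "g x = h x" for x
      by (rule pair.linear_eq_on[OF that(1,2) _ that(3), of x Basis]) (simp_all add: span_Basis)
  qed
  have "inj \<Phi>"
    unfolding \<Phi>.inj_iff_eq_0
  proof (intro allI impI)
    fix x assume "\<Phi> x = 0"
    then have "(\<Sum>e\<in>Basis. scale (b x e) e) = (\<Sum>e\<in>Basis. scale 0 e)"
      by (simp add: \<Phi>_def)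
    then have "b x = (\<lambda>y. 0)"
      by (intro eqI bl(2) pair.linear_zero coeffs)
    then show "x = 0" using nd by metis
  qed
  then have "surj \<Phi>"
    using linear_inj_imp_surj \<Phi>.linear_axioms by blast
  then obtain x where "\<Phi> x = (\<Sum>e\<in>Basis. scale (f e) e)"
    by (metis surjD)
  then have "b x e = f e" if "e \<in> Basis" for e
    using coeffs that unfolding \<Phi>_def by blast
  then have "f = b x"
    by (intro eqI f bl(2)) auto
  then show thesis by (rule that)
qed

end

section \<open>Lie algebras\<close>

context lie_algebra
begin

text \<open>The locale \<open>finite_dimensional_vector_space\<close> fixes a basis; one is selected
  from a finite spanning set so that later proofs can interpret the locale.\<close>

lemma finite_dimensional_vector_space_ex: "\<exists>B. finite_dimensional_vector_space scale B"
proof -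
  obtain S where S: "finite S" "span S = UNIV"
    using finite_dimensional by blast
  obtain B where B: "B \<subseteq> S" "independent B" "S \<subseteq> span B"
    using maximal_independent_subset by blast
  have "span B = UNIV"
    using S B by (metis span_minimal subspace_span top.extremum_uniqueI)
  moreover have "finite B" using S B finite_subset by blast
  ultimately have "finite_dimensional_vector_space scale B"
    using B by unfold_locales auto
  then show ?thesis ..
qed

lemma linear_bracket_right: "Vector_Spaces.linear scale scale (\<lambda>y. bracket x y)"
  and linear_bracket_left: "Vector_Spaces.linear scale scale (\<lambda>x. bracket x y)"
  using bracket_bilinear by (auto simp: bilinear_map_def)

lemma bracket_add_left: "bracket (x + y) z = bracket x z + bracket y z"
  and bracket_add_right: "bracket x (y + z) = bracket x y + bracket x z"
  and bracket_scale_left: "bracket (scale c x) z = scale c (bracket x z)"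
  using linear_bracket_left[of z] linear_bracket_right[of x] by (auto simp: Vector_Spaces.linear_iff)

lemma bracket_anticommute: "bracket y x = - bracket x y"
  using bracket_alternating[of "x + y"] bracket_alternating[of x] bracket_alternating[of y]
  by (simp add: bracket_add_left bracket_add_right eq_neg_iff_add_eq_0 add.commute)

lemma dualD:
  assumes "f \<in> dual"
  shows "f (x + y) = f x + f y" "f (scale c x) = c * f x" "f (- x) = - f x" "f 0 = 0"
proof -
  interpret Vector_Spaces.linear scale "(*)" f using assms by (simp add: dual_def)
  show "f (x + y) = f x + f y" "f (scale c x) = c * f x" "f (- x) = - f x" "f 0 = 0"
    by (simp_all add: add scale neg)
qed

lemma subspace_stabilizer: "f \<in> dual \<Longrightarrow> subspace (stabilizer f)"
  using dualD(4)[of f] linear_bracket_left[THEN Vector_Spaces.linear.axioms(3), THEN module_hom.zero]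
  by (auto intro!: subspaceI simp: stabilizer_def bracket_add_left bracket_scale_left dualD)

lemma index_le: "f \<in> dual \<Longrightarrow> index \<le> dim (stabilizer f)"
  unfolding index_def by (rule Least_le) blast

text \<open>The dual contains the zero functional, so the minimum defining \<open>index\<close> is
  attained.\<close>

lemma regular_exists: "\<exists>f. f \<in> regular"
proof -
  have "(\<lambda>_. 0) \<in> dual"
    by (simp add: dual_def Vector_Spaces.linear_iff vector_space_axioms vector_space_mult)
  then have "\<exists>n. \<exists>f\<in>dual. n = dim (stabilizer f)" by blast
  then have "\<exists>f\<in>dual. index = dim (stabilizer f)"
    unfolding index_def by (rule LeastI_ex)
  then show ?thesis by (auto simp: regular_def)
qed

section \<open>Isotropic subspaces and commutative polarizations\<close>

text \<open>For \<open>x\<close> in \<open>Q\<close> the functional sending \<open>y\<close> to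
  \<open>f (bracket x y)\<close> vanishes on \<open>Q\<close>, so these functionals form a space of
  dimension at most \<open>dim UNIV - dim Q\<close>. It is zero only for \<open>x\<close> in the
  stabilizer, and rank-nullity gives the bound.\<close>

lemma dim_isotropic_le:
  assumes f: "f \<in> dual" and Q: "subspace Q"
    and iso: "\<And>x y. x \<in> Q \<Longrightarrow> y \<in> Q \<Longrightarrow> f (bracket x y) = 0"
  shows "2 * dim Q \<le> dim (UNIV :: 'l set) + dim (stabilizer f)"
proof -
  obtain B0 where "finite_dimensional_vector_space scale B0"
    using finite_dimensional_vector_space_ex by blast
  then interpret fd: finite_dimensional_vector_space scale B0 .
  interpret pair: vector_space_pair scale "(*) :: 'k \<Rightarrow> 'k \<Rightarrow> 'k"
    by (simp add: vector_space_pair_def vector_space_axioms vector_space_mult)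
  obtain C where C: "C \<subseteq> Q" "independent C" "Q \<subseteq> span C" "card C = dim Q"
    using basis_exists by blast
  obtain B where B: "C \<subseteq> B" "independent B" "UNIV \<subseteq> span B"
    using maximal_independent_subset_extend[of C UNIV] C by auto
  have fB: "finite B" using B fd.finiteI_independent by blast
  have cB: "card B = dim (UNIV :: 'l set)"
    using basis_card_eq_dim[OF subset_UNIV B(3,2)] .
  \<comment> \<open>The kernel of \<open>T\<close> is the stabilizer, and \<open>T\<close> maps \<open>Q\<close> into the span of \<open>B - C\<close>.\<close>
  define T where "T x = (\<Sum>e\<in>B. scale (f (bracket x e)) e)" for x
  have "Vector_Spaces.linear scale (*) (\<lambda>x. f (bracket x e))" for e
    using Vector_Spaces.linear_compose[OF linear_bracket_left, of "(*)" f e] f by (simp add: dual_def o_def)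
  then have T: "Vector_Spaces.linear scale scale T"
    unfolding T_def by (intro linear_coordinate_sum)
  have "x \<in> stabilizer f" if "T x = 0" for x
  proof -
    have *: "f (bracket x e) = 0" if "e \<in> B" for e
      using independentD[OF B(2) fB subset_refl _ that] \<open>T x = 0\<close> unfolding T_def .
    have lin: "Vector_Spaces.linear scale (*) (\<lambda>y. f (bracket x y))"
      using Vector_Spaces.linear_compose[OF linear_bracket_right, of "(*)" f x] f by (simp add: dual_def o_def)
    have "f (bracket x y) = 0" for y
      by (rule pair.linear_eq_on[OF lin pair.linear_zero _ *, of y B]) (use B(3) in auto)
    then show ?thesis by (simp add: stabilizer_def)
  qed
  then have "dim (Q \<inter> {x. T x = 0}) \<le> dim (stabilizer f)"
    by (intro fd.dim_subset) auto
  moreover have "dim (T ` Q) \<le> dim (UNIV :: 'l set) - dim Q"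
  proof -
    \<comment> \<open>The coefficients at \<open>C\<close> vanish because \<open>C\<close> lies in
      the isotropic subspace \<open>Q\<close>.\<close>
    have "T x = (\<Sum>e\<in>B - C. scale (f (bracket x e)) e)" if "x \<in> Q" for x
      unfolding T_def using that iso C(1) B(1) fB
      by (intro sum.mono_neutral_right) (auto dest: subsetD)
    then have "T ` Q \<subseteq> span (B - C)"
      by (intro image_subsetI) (simp only:, intro span_sum span_scale span_base)
    then have "dim (T ` Q) \<le> card (B - C)"
      using fB by (intro dim_le_card) auto
    also have "\<dots> = dim (UNIV :: 'l set) - dim Q"
      using C(4) cB B(1) fB by (simp add: card_Diff_subset finite_subset)
    finally show ?thesis .
  qed
  moreover have "dim Q \<le> dim (UNIV :: 'l set)"
    by (intro fd.dim_subset) simp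
  ultimately show ?thesis
    using fd.dim_le_kernel_plus_image[OF T Q] by linarith
qed

lemma stabilizer_subset_commutative_polarization:
  assumes P: "commutative_polarization P" and g: "g \<in> regular"
  shows "stabilizer g \<subseteq> P"
proof -
  obtain B where "finite_dimensional_vector_space scale B"
    using finite_dimensional_vector_space_ex by blast
  then interpret fd: finite_dimensional_vector_space scale B .
  obtain f where f: "f \<in> dual" and dimP: "2 * dim P = dim (UNIV :: 'l set) + dim (stabilizer f)"
    using P by (auto simp: commutative_polarization_def polarization_def)
  have sP: "subspace P" and com: "\<And>x y. x \<in> P \<Longrightarrow> y \<in> P \<Longrightarrow> bracket x y = 0"
    using P by (auto simp: commutative_polarization_def lie_subalgebra_def commutative_def)
  \<comment> \<open>The functional \<open>f\<close> polarized by \<open>P\<close> may differ from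
    \<open>g\<close>; minimality of the index compares their stabilizers.\<close>
  have gd: "g \<in> dual" and gi: "dim (stabilizer g) \<le> dim (stabilizer f)"
    using g index_le[OF f] by (auto simp: regular_def)
  note sg = subspace_stabilizer[OF gd]
  let ?Q = "{x + y |x y. x \<in> P \<and> y \<in> stabilizer g}"
  have sQ: "subspace ?Q"
    by (rule subspace_sums[OF sP sg])
  have stab: "g (bracket y z) = 0" "g (bracket z y) = 0" if "y \<in> stabilizer g" for y z
    using that bracket_anticommute[of z y] by (auto simp: stabilizer_def dualD[OF gd])
  have "2 * dim ?Q \<le> dim (UNIV :: 'l set) + dim (stabilizer g)"
    by (rule dim_isotropic_le[OF gd sQ])
       (auto simp: bracket_add_left bracket_add_right dualD[OF gd] stab com)
  then have "dim ?Q \<le> dim P"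
    using dimP gi by linarith
  moreover have "P \<subseteq> ?Q"
    using subspace_0[OF sg] by force
  ultimately have "P = ?Q"
    using fd.subspace_dim_equal[OF sP sQ] by blast
  moreover have "stabilizer g \<subseteq> ?Q"
    using subspace_0[OF sP] by force
  ultimately show ?thesis by blast
qed

lemma frobenius_semiradical_subset_commutative_polarization:
  assumes "commutative_polarization P"
  shows "frobenius_semiradical \<subseteq> P"
  unfolding frobenius_semiradical_def
proof (rule span_minimal)
  show "(\<Union>f\<in>regular. stabilizer f) \<subseteq> P"
    using stabilizer_subset_commutative_polarization[OF assms] by blast
  show "subspace P"
    using assms by (simp add: commutative_polarization_def lie_subalgebra_def)
qed

section \<open>Lie algebras with an invariant form\<close>

text \<open>By invariance, \<open>b x\<close> kills every \<open>bracket y z\<close> exactly when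
  \<open>b (bracket x y)\<close> kills every \<open>z\<close>, which nondegeneracy turns into
  \<open>bracket x y = 0\<close>.\<close>

lemma stabilizer_invariant_form:
  assumes "bilinear_map scale scale (*) b" and nd: "nondegenerate b" and inv: "invariant_form b"
  shows "stabilizer (b x) = {y. bracket x y = 0}"
proof -
  have "Vector_Spaces.linear scale (*) (\<lambda>y. b 0 y)" "Vector_Spaces.linear scale (*) (\<lambda>x. b x z)" for z
    using assms(1) by (auto simp: bilinear_map_def)
  then have "b 0 z = 0" for z
    by (metis Vector_Spaces.linear.axioms(3) module_hom.zero)
  moreover have "b x (bracket y z) = b (bracket x y) z" for y z
    using inv by (simp add: invariant_form_def)
  ultimately show ?thesis
    using nd unfolding stabilizer_def nondegenerate_def by (metis (no_types, lifting))
qed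

lemma frobenius_semiradical_eq_UNIV:
  assumes b: "bilinear_map scale scale (*) b" and nd: "nondegenerate b" and inv: "invariant_form b"
  shows "frobenius_semiradical = UNIV"
proof -
  obtain B where "finite_dimensional_vector_space scale B"
    using finite_dimensional_vector_space_ex by blast
  then interpret fd: finite_dimensional_vector_space scale B .
  note stab = stabilizer_invariant_form[OF b nd inv]
  have dual: "b x \<in> dual" for x
    using b by (simp add: bilinear_map_def dual_def)
  have mem: "x \<in> frobenius_semiradical" if "b x \<in> regular" for x
    unfolding frobenius_semiradical_def
    by (rule span_base, rule UN_I[OF that]) (simp add: stab bracket_alternating)
  obtain f where f: "f \<in> regular" using regular_exists by blast
  then obtain x where x: "f = b x"
    using fd.nondegenerate_form_represents[OF b, of f] nd
    by (auto simp: regular_def dual_def nondegenerate_def)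
  have "y \<in> frobenius_semiradical" for y
  proof -
    \<comment> \<open>By \<open>stab\<close> these kernels are the stabilizers of \<open>b x\<close>
      and \<open>b (x + scale t y)\<close>, so \<open>?J\<close> collects the parameters at which
      regularity is lost.\<close>
    let ?J = "{t. dim {z. bracket x z = 0} < dim {z. bracket x z + scale t (bracket y z) = 0}}"
    have "finite (insert 0 ?J)"
      using fd.finite_kernel_pencil_jumps[OF linear_bracket_right linear_bracket_right] by simp
    \<comment> \<open>Characteristic zero makes the field infinite; \<open>0\<close> is excluded
      too, so that dividing by \<open>t\<close> recovers \<open>y\<close>.\<close>
    from ex_new_if_finite[OF infinite_UNIV_char_0 this]
    obtain t where "t \<notin> insert 0 ?J" ..
    then have t: "t \<noteq> 0" "t \<notin> ?J" by blast+
    have "dim (stabilizer (b (x + scale t y))) \<le> dim (stabilizer (b x))"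
      using t(2) unfolding stab bracket_add_left bracket_scale_left mem_Collect_eq not_less .
    also have "\<dots> = index"
      using f x by (simp add: regular_def)
    finally have "b (x + scale t y) \<in> regular"
      using index_le[OF dual] dual by (simp add: regular_def le_antisym)
    then have "scale (1 / t) ((x + scale t y) - x) \<in> frobenius_semiradical"
      using mem f x unfolding frobenius_semiradical_def by (metis span_diff span_scale)
    then show ?thesis using t(1) by simp
  qed
  then show ?thesis by blast
qed

end

theorem theorem3p2:
  fixes scale :: "'k::field_char_0 \<Rightarrow> 'l::ab_group_add \<Rightarrow> 'l"
    and bracket :: "'l \<Rightarrow> 'l \<Rightarrow> 'l"
    and b :: "'l \<Rightarrow> 'l \<Rightarrow> 'k"
  assumes "lie_algebra scale bracket"
    and "bilinear_map scale scale (*) b"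
    and "nondegenerate b"
    and "lie_algebra.invariant_form bracket b"
  shows "lie_algebra.frobenius_semiradical scale bracket = UNIV \<and>
    (\<not> lie_algebra.abelian bracket \<longrightarrow>
      \<not> (\<exists>P. lie_algebra.commutative_polarization scale bracket P))"
proof -
  interpret lie_algebra scale bracket by fact
  have F: "frobenius_semiradical = UNIV"
    using assms(2-4) by (rule frobenius_semiradical_eq_UNIV)
  \<comment> \<open>Such a \<open>P\<close> contains the semiradical, hence is everything, and it is
    commutative.\<close>
  have "abelian" if "commutative_polarization P" for P
    using frobenius_semiradical_subset_commutative_polarization[OF that] that F
    by (simp add: abelian_def commutative_polarization_def top.extremum_unique)
  with F show ?thesis by blast
qed

end
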